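(* Consider an instance of the PRTRP with $n$ fault locations. Given a vertex $i\in V_c$, for any position $k\in\{1,\dots,n\}$ with $k>n-|S_i|$, the total service disruption time of any Hamiltonian cycle that visits vertex $i$ in the $k$-th position is lower bounded by $L_i^k$, where $$L_i^k=\sum_{\substack{1\le p\le n:\\ p\le n-|S_i|\ \text{or}\ p\ge k+1}}(n-p+1)\,s_p+|S_i|\sum_{p=n-|S_i|+1}^{k}s_p.$$
   Context: Instance of the Power Restoration Traveling Repairman Problem (PRTRP): Let $n\ge 1$, let $V_c=\{1,2,\dots,n\}$ be the set of fault locations (customers), let vertex $0$ be the depot, and let $V=V_c\cup\{0\}$. The road network is a complete directed graph $G=(V,A)$, where each arc $(i,j)\in A$ ($i\neq j$) represents a shortest path from location $i$ to location $j$ and has travel time (length) $d_{ij}\ge 0$. The power network is a directed tree $T=(V_c,A_c)$ rooted at vertex $1$ (the unique power source, with all arcs directed away from it). Write $i\succeq j$ if $i=j$ or $j$ is reachable from $i$ by a directed path in $T$. Repair durations are zero. Solutions and objective: A solution is a Hamiltonian cycle $H=(j_0=0,j_1,\dots,j_n,0)$ in $G$ starting at the depot; $H$ visits vertex $i$ in the $k$-th position if $j_k=i$. The crew leaves the depot at time $0$ and arrives at $j_p$ at time $t_{j_p}=\sum_{q=1}^{p}d_{j_{q-1}j_q}$, repairing the fault there instantaneously. The service disruption time of $j\in V_c$ is $r_j=\max\{t_i : i\succeq j\}$. The total service disruption time of $H$ is $\sum_{j\in V_c}r_j$. Notation: $S_i=\{j\in V_c : i\succeq j\}$ is the set of successors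 of $i$ in the power network, including $i$, and $|S_i|$ is its cardinality. $s_p$ is the length of the $p$-th shortest arc in the road network $G$ (arc lengths sorted in non-decreasing order, with multiplicity). *)

theory Defs
  imports
    "Graph_Theory.Pair_Digraph"
    "Graph_Theory.Vertex_Walk"
    "HOL-Library.Multiset"
    Complex_Main
begin

text \<open>
  The predicate \<open>tree\<close> of the Graph Theory library only forbids directed cycles and hence
  admits, e.g., two internally disjoint directed paths from the root to a vertex.
  We use the usual notion of a directed tree with all arcs directed away from the root.
\<close>

locale rooted_directed_tree = wf_digraph T for T :: "('a, 'b) pre_digraph" +
  fixes root :: 'a
  assumes root_in_verts: "root \<in> verts T"
    and unique_awalk: "v \<in> verts T \<Longrightarrow> \<exists>!p. awalk root p v"

text \<open>
  A Hamiltonian cycle is given by its closed vertex sequence, the first vertex being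
  repeated at the end. Cycles with two arcs are allowed (digraph on two vertices).
\<close>

definition hamiltonian_cycle :: "('a, 'b) pre_digraph \<Rightarrow> 'a vwalk \<Rightarrow> bool" where
  "hamiltonian_cycle G H \<longleftrightarrow>
     vwalk H G \<and> tl H \<noteq> [] \<and> hd H = last H \<and> distinct (tl H) \<and> set H = verts G"

definition road_network :: "nat \<Rightarrow> nat pair_pre_digraph" where
  "road_network n = \<lparr> pverts = {0..n}, parcs = {(i, j). i \<le> n \<and> j \<le> n \<and> i \<noteq> j} \<rparr>"

locale prtrp =
  fixes n :: nat
    and d :: "nat \<Rightarrow> nat \<Rightarrow> real"
    and T :: "nat pair_pre_digraph"
  assumes n_ge_1: "1 \<le> n"
    and travel_time_nonneg: "(i, j) \<in> parcs (road_network n) \<Longrightarrow> 0 \<le> d i j"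
    and power_network_verts: "pverts T = {1..n}"
    and power_network_tree: "rooted_directed_tree (with_proj T) 1"

definition successors :: "nat pair_pre_digraph \<Rightarrow> nat \<Rightarrow> nat set" where
  "successors T i = {j \<in> pverts T. i \<rightarrow>\<^sup>*\<^bsub>with_proj T\<^esub> j}"

text \<open>
  The positions of a Hamiltonian cycle \<open>[0, j\<^sub>1, \<dots>, j\<^sub>n, 0]\<close> are its list indices; the depot
  occupies indices \<open>0\<close> and \<open>n + 1\<close>, and each fault location exactly one index in \<open>{1..n}\<close>.
\<close>

definition visit_position :: "nat \<Rightarrow> nat vwalk \<Rightarrow> nat \<Rightarrow> nat" where
  "visit_position n H i = (THE k. k \<in> {1..n} \<and> H ! k = i)"

definition arrival_time :: "nat \<Rightarrow> (nat \<Rightarrow> nat \<Rightarrow> real) \<Rightarrow> nat vwalk \<Rightarrow> nat \<Rightarrow> real" where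
  "arrival_time n d H i = (\<Sum>q = 1..visit_position n H i. d (H ! (q - 1)) (H ! q))"

definition disruption_time ::
  "nat \<Rightarrow> (nat \<Rightarrow> nat \<Rightarrow> real) \<Rightarrow> nat pair_pre_digraph \<Rightarrow> nat vwalk \<Rightarrow> nat \<Rightarrow> real" where
  "disruption_time n d T H j =
     Max {arrival_time n d H i | i. i \<in> pverts T \<and> i \<rightarrow>\<^sup>*\<^bsub>with_proj T\<^esub> j}"

definition total_disruption_time ::
  "nat \<Rightarrow> (nat \<Rightarrow> nat \<Rightarrow> real) \<Rightarrow> nat pair_pre_digraph \<Rightarrow> nat vwalk \<Rightarrow> real" where
  "total_disruption_time n d T H = (\<Sum>j \<in> pverts T. disruption_time n d T H j)"

text \<open>The length of the \<open>p\<close>-th shortest arc of the road network, for \<open>1 \<le> p \<le> n * (n + 1)\<close>.\<close>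

definition shortest_arc :: "nat \<Rightarrow> (nat \<Rightarrow> nat \<Rightarrow> real) \<Rightarrow> nat \<Rightarrow> real" where
  "shortest_arc n d p =
     sorted_list_of_multiset {# d i j. (i, j) \<in># mset_set (parcs (road_network n)) #} ! (p - 1)"

definition disruption_lower_bound ::
  "nat \<Rightarrow> (nat \<Rightarrow> nat \<Rightarrow> real) \<Rightarrow> nat pair_pre_digraph \<Rightarrow> nat \<Rightarrow> nat \<Rightarrow> real" where
  "disruption_lower_bound n d T i k =
     (\<Sum>p | 1 \<le> p \<and> p \<le> n \<and> (p \<le> n - card (successors T i) \<or> k + 1 \<le> p).
        real (n - p + 1) * shortest_arc n d p)
     + real (card (successors T i))
       * (\<Sum>p = n - card (successors T i) + 1..k. shortest_arc n d p)"

end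

theory Submission
  imports Defs
begin

text \<open>
  Let \<open>x\<^sub>q\<close> be the length of the \<open>q\<close>-th arc of the cycle, and let \<open>s = |S\<^sub>i|\<close>. A fault location \<open>j\<close>
  at position \<open>p\<close> suffers disruption for at least \<open>x\<^sub>1 + \<dots> + x\<^sub>p\<close>, and a successor \<open>j\<close> of \<open>i\<close>
  also for at least \<open>x\<^sub>1 + \<dots> + x\<^sub>k\<close>, because power cannot return before \<open>i\<close> is repaired.
  Exchanging the order of summation, the total disruption time is at least \<open>\<Sum>\<^sub>q c\<^sub>q x\<^sub>q\<close>, where
  \<open>c\<^sub>q\<close> counts the locations that wait for the \<open>q\<close>-th arc. The \<open>n - q + 1\<close> locations at positions
  \<open>\<ge> q\<close> always do, and all \<open>s\<close> successors of \<open>i\<close> do when \<open>q \<le> k\<close>. As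
  \<open>x\<^sub>q \<ge> 0\<close>, each \<open>c\<^sub>q\<close> may be lowered to \<open>w\<^sub>q\<close>, where
  \<open>w\<^sub>q = s\<close> for \<open>n - s < q \<le> k\<close> and \<open>w\<^sub>q = n - q + 1\<close> otherwise; these \<open>w\<^sub>q\<close> are exactly the
  coefficients of the lower bound (\<open>arc_weight\<close>, \<open>weighted_legs_le_total_disruption\<close>).

  It remains to replace the arcs of the cycle by the shortest arcs of the network. The first
  \<open>m\<close> arcs of the cycle are distinct, so together they are at least as long as the \<open>m\<close> shortest
  arcs (\<open>sum_shortest_arcs_le_legs\<close>). Since \<open>k > n - s\<close>, the weights \<open>w\<^sub>q\<close> are nonincreasing, and
  summation by parts (\<open>weighted_sum_mono_of_prefix_sums\<close>) turns the comparison of all prefix sums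
  into the comparison of the weighted sums.
\<close>

section \<open>Sums over sorted lists and weighted sums\<close>

text \<open>
  If the least element \<open>a\<close> of the list is in the submultiset, both can be cancelled. If it
  is not, any element of the submultiset is at least \<open>a\<close> and can play its part.
\<close>

lemma sum_list_take_sorted_le_sum_mset:
  fixes xs :: "'a :: {linorder, ordered_comm_monoid_add} list"
  assumes "sorted xs" and "X \<subseteq># mset xs"
  shows "sum_list (take (size X) xs) \<le> sum_mset X"
  using assms
proof (induction xs arbitrary: X)
  case Nil
  then show ?case by simp
next
  case (Cons a xs)
  show ?case
  proof (cases "X = {#}")
    case True
    then show ?thesis by simp
  next
    case False
    have "\<exists>y \<in># X. X - {#y#} \<subseteq># mset xs \<and> a \<le> y"
    proof (cases "a \<in># X")
      case True
      with Cons.prems(2) have "X - {#a#} \<subseteq># mset xs"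
        by (simp add: subset_eq_diff_conv)
      with True show ?thesis by auto
    next
      case a_notin: False
      obtain y where y: "y \<in># X"
        using False by blast
      have "X \<subseteq># mset xs"
        using Cons.prems(2) a_notin
        by (metis diff_single_trivial mset.simps(2) subset_eq_diff_conv add_mset_add_single)
      then have "X - {#y#} \<subseteq># mset xs" and "y \<in> set xs"
        using y by (meson diff_subset_eq_self subset_mset.order_trans, auto dest: mset_subset_eqD)
      with Cons.prems(1) y show ?thesis by auto
    qed
    then obtain y Y where X: "X = add_mset y Y" and Y: "Y \<subseteq># mset xs" and "a \<le> y"
      by (metis insert_DiffM)
    have "sum_list (take (size Y) xs) \<le> sum_mset Y"
      using Cons.IH Cons.prems(1) Y by simp
    with \<open>a \<le> y\<close> show ?thesis
      by (simp add: X add_mono)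
  qed
qed

lemma weighted_sum_mono_of_prefix_sums:
  fixes w x y :: "nat \<Rightarrow> real"
  assumes antimono: "\<And>q. 1 \<le> q \<Longrightarrow> q < n \<Longrightarrow> w (Suc q) \<le> w q"
    and nonneg: "0 \<le> w n"
    and prefix: "\<And>m. m \<le> n \<Longrightarrow> (\<Sum>q = 1..m. x q) \<le> (\<Sum>q = 1..m. y q)"
  shows "(\<Sum>q = 1..n. w q * x q) \<le> (\<Sum>q = 1..n. w q * y q)"
proof -
  define D where "D m = (\<Sum>q = 1..m. y q) - (\<Sum>q = 1..m. x q)" for m
  have D_nonneg: "0 \<le> D m" if "m \<le> n" for m
    using prefix[OF that] by (simp add: D_def)
  have "w m * D m \<le> (\<Sum>q = 1..m. w q * y q) - (\<Sum>q = 1..m. w q * x q)" if "m \<le> n" for m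
    using that
  proof (induction m)
    case 0
    then show ?case by (simp add: D_def)
  next
    case (Suc m)
    have "w (Suc m) * D m \<le> w m * D m"
    proof (cases "m = 0")
      case True
      then show ?thesis by (simp add: D_def)
    next
      case False
      with Suc.prems antimono[of m] D_nonneg[of m] show ?thesis
        by (intro mult_right_mono) auto
    qed
    with Suc show ?case
      by (simp add: D_def algebra_simps)
  qed
  from this[of n] D_nonneg[of n] nonneg show ?thesis
    by (smt (verit) mult_nonneg_nonneg order_refl)
qed

section \<open>Hamiltonian cycles through the depot\<close>

text \<open>
  The tail of the closed vertex sequence lists every vertex once. It ends with the depot, so
  dropping its last entry leaves a list of the fault locations.
\<close>

lemma hamiltonian_cycle_bij_betw:
  assumes "hamiltonian_cycle (with_proj (road_network n)) H" and "hd H = 0"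
  shows "bij_betw ((!) H) {1..n} {1..n}"
proof -
  from assms obtain vs where H: "H = 0 # vs" and vs: "vs \<noteq> []" "distinct vs" "last vs = 0"
    and "set H = {0..n}"
    unfolding hamiltonian_cycle_def road_network_def
    by (cases H) auto
  have "0 \<in> set vs"
    using vs by (metis last_in_set)
  with \<open>set H = {0..n}\<close> H have set_vs: "set vs = {0..n}"
    by (simp add: insert_absorb)
  then have len: "length vs = Suc n"
    using distinct_card[OF vs(2)] by simp
  have nth_n: "vs ! n = 0"
    using vs len by (simp add: last_conv_nth)
  have "bij_betw ((!) vs) {..<Suc n} {0..n}"
    using vs(2) len set_vs by (intro bij_betw_nth) auto
  then have "bij_betw ((!) vs) ({..<Suc n} - {n}) ({0..n} - {vs ! n})"
    using nth_n by (intro bij_betw_DiffI) auto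
  moreover have "{..<Suc n} - {n} = {..<n}" "{0..n} - {vs ! n} = {1..n}"
    using nth_n by auto
  ultimately have "bij_betw ((!) vs) {..<n} {1..n}"
    by simp
  moreover have "bij_betw (\<lambda>p. p - 1) {1..n} {..<n}"
    by (rule bij_betw_byWitness[where f' = Suc]) auto
  ultimately have "bij_betw ((!) vs \<circ> (\<lambda>p. p - 1)) {1..n} {1..n}"
    by (rule bij_betw_trans[rotated])
  moreover have "((!) vs \<circ> (\<lambda>p. p - 1)) p = H ! p" if "p \<in> {1..n}" for p
    using that by (simp add: H)
  ultimately show ?thesis
    by (metis (no_types, lifting) bij_betw_cong)
qed

lemma visit_position_nth:
  assumes "bij_betw ((!) H) {1..n} {1..n}" and "p \<in> {1..n}"
  shows "visit_position n H (H ! p) = p"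
  unfolding visit_position_def
proof (rule the_equality)
  show "p \<in> {1..n} \<and> H ! p = H ! p"
    using assms(2) by simp
  show "q = p" if "q \<in> {1..n} \<and> H ! q = H ! p" for q
    using that assms by (metis bij_betw_imp_inj_on inj_onD)
qed

lemma leg_in_road_network:
  assumes bij: "bij_betw ((!) H) {1..n} {1..n}" and "H ! 0 = 0" and q: "q \<in> {1..n}"
  shows "(H ! (q - 1), H ! q) \<in> parcs (road_network n)"
proof (cases "q = 1")
  case True
  moreover have "H ! q \<in> {1..n}"
    using bij q by (auto simp: bij_betw_def)
  ultimately show ?thesis
    using \<open>H ! 0 = 0\<close> by (auto simp: road_network_def)
next
  case False
  then have "q - 1 \<in> {1..n}" "q - 1 \<noteq> q"
    using q by auto
  moreover from this q have "H ! (q - 1) \<noteq> H ! q"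
    using bij by (metis bij_betw_imp_inj_on inj_onD)
  ultimately have "H ! (q - 1) \<in> {1..n}" "H ! q \<in> {1..n}" "H ! (q - 1) \<noteq> H ! q"
    using q bij by (metis bij_betwE)+
  then show ?thesis
    by (auto simp: road_network_def)
qed

text \<open>
  The cycle enters every vertex only once, so its arcs are pairwise distinct and their
  lengths form a submultiset of the multiset of all arc lengths.
\<close>

lemma sum_shortest_arcs_le_legs:
  assumes bij: "bij_betw ((!) H) {1..n} {1..n}" and "H ! 0 = 0" and "m \<le> n"
  shows "(\<Sum>p = 1..m. shortest_arc n d p) \<le> (\<Sum>q = 1..m. d (H ! (q - 1)) (H ! q))"
proof -
  define A where "A = parcs (road_network n)"
  define M where "M = {# d i j. (i, j) \<in># mset_set A #}"
  define leg where "leg q = (H ! (q - 1), H ! q)" for q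
  define X where "X = {# d i j. (i, j) \<in># mset_set (leg ` {1..m}) #}"
  have "finite A"
    by (rule finite_subset[of _ "{0..n} \<times> {0..n}"]) (auto simp: A_def road_network_def)
  have inj: "inj_on ((!) H) {1..n}"
    using bij by (simp add: bij_betw_def)
  have "leg ` {1..m} \<subseteq> A"
    using leg_in_road_network[OF bij \<open>H ! 0 = 0\<close>] \<open>m \<le> n\<close> by (auto simp: leg_def A_def)
  then have "mset_set (leg ` {1..m}) \<subseteq># mset_set A"
    using \<open>finite A\<close> by (intro subset_imp_msubset_mset_set)
  then have sub: "X \<subseteq># M"
    unfolding X_def M_def by (rule image_mset_subseteq_mono)
  have leg_inj: "inj_on leg {1..m}"
  proof (rule inj_onI)
    fix p q assume "p \<in> {1..m}" "q \<in> {1..m}" "leg p = leg q"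
    then have "H ! p = H ! q" "p \<in> {1..n}" "q \<in> {1..n}"
      using \<open>m \<le> n\<close> by (simp_all add: leg_def)
    with inj show "p = q"
      by (rule inj_onD)
  qed
  have size_X: "size X = m"
    using leg_inj by (simp add: X_def card_image)
  have "sum_mset X = (\<Sum>(a, b)\<in>leg ` {1..m}. d a b)"
    by (simp only: X_def sum_unfold_sum_mset)
  also have "\<dots> = (\<Sum>q = 1..m. d (H ! (q - 1)) (H ! q))"
    by (subst sum.reindex[OF leg_inj]) (simp add: leg_def)
  finally have sum_X: "sum_mset X = (\<Sum>q = 1..m. d (H ! (q - 1)) (H ! q))" .
  define L where "L = sorted_list_of_multiset M"
  have len: "m \<le> length L"
    using size_mset_mono[OF sub] size_X
    by (metis L_def mset_sorted_list_of_multiset size_mset)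
  have "(\<Sum>p = 1..m. shortest_arc n d p) = (\<Sum>p = 1..m. L ! (p - 1))"
    by (simp add: shortest_arc_def L_def M_def A_def)
  also have "\<dots> = (\<Sum>p = 0..<m. L ! p)"
    by (rule sum.reindex_bij_witness[where i = Suc and j = "\<lambda>p. p - 1"]) auto
  also have "\<dots> = sum_list (take m L)"
    using len by (simp add: sum_list_sum_nth min_def)
  also have "\<dots> \<le> sum_mset X"
    using sum_list_take_sorted_le_sum_mset[of L X] sub size_X by (simp add: L_def)
  finally show ?thesis
    by (simp add: sum_X)
qed

section \<open>Weights of the arcs in the total disruption time\<close>

text \<open>
  A lower bound on the number of fault locations that wait for the \<open>p\<close>-th arc, given that \<open>s\<close>
  locations wait for the vertex at position \<open>k\<close>.
\<close>

definition arc_weight :: "nat \<Rightarrow> nat \<Rightarrow> nat \<Rightarrow> nat \<Rightarrow> nat" where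
  "arc_weight n s k p = (if p \<le> n - s \<or> k + 1 \<le> p then n - p + 1 else s)"

lemma disruption_lower_bound_eq_weighted_sum:
  assumes "k \<le> n"
  shows "disruption_lower_bound n d T i k =
    (\<Sum>p = 1..n. real (arc_weight n (card (successors T i)) k p) * shortest_arc n d p)"
proof -
  define s where "s = card (successors T i)"
  define P where "P p \<longleftrightarrow> p \<le> n - s \<or> k + 1 \<le> p" for p
  have "{n - s + 1..k} = {p \<in> {1..n}. \<not> P p}"
    using assms by (auto simp: P_def)
  moreover have "{p. 1 \<le> p \<and> p \<le> n \<and> (p \<le> n - s \<or> k + 1 \<le> p)} = {p \<in> {1..n}. P p}"
    by (auto simp: P_def)
  ultimately have "disruption_lower_bound n d T i k =
      (\<Sum>p | p \<in> {1..n} \<and> P p. real (n - p + 1) * shortest_arc n d p)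
      + (\<Sum>p | p \<in> {1..n} \<and> \<not> P p. real s * shortest_arc n d p)"
    unfolding disruption_lower_bound_def s_def[symmetric] by (simp only: sum_distrib_left)
  also have "\<dots> = (\<Sum>p = 1..n. if P p then real (n - p + 1) * shortest_arc n d p
      else real s * shortest_arc n d p)"
    by (simp add: sum.If_cases Int_def del: Collect_conj_eq)
  also have "\<dots> = (\<Sum>p = 1..n. real (arc_weight n s k p) * shortest_arc n d p)"
    by (intro sum.cong) (auto simp: arc_weight_def P_def)
  finally show ?thesis
    by (simp add: s_def)
qed

lemma arrival_time_le_disruption_time:
  assumes "finite (pverts T)" and "i \<in> pverts T" and "i \<rightarrow>\<^sup>*\<^bsub>with_proj T\<^esub> j"
  shows "arrival_time n d H i \<le> disruption_time n d T H j"
  unfolding disruption_time_def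
  using assms by (intro Max_ge) auto

text \<open>
  Writing each waiting time as a sum over the arcs waited for and exchanging the two
  sums reduces the claim to counting, for each arc, the locations that wait for it.
\<close>

lemma weighted_legs_le_total_disruption:
  assumes "prtrp n d T"
    and bij: "bij_betw ((!) H) {1..n} {1..n}" and "H ! 0 = 0"
    and k: "k \<in> {1..n}"
  shows "(\<Sum>q = 1..n. real (arc_weight n (card (successors T (H ! k))) k q) *
    d (H ! (q - 1)) (H ! q)) \<le> total_disruption_time n d T H"
proof -
  interpret prtrp n d T by fact
  define S where "S = successors T (H ! k)"
  define x where "x q = d (H ! (q - 1)) (H ! q)" for q
  have verts: "pverts T = {1..n}"
    by (rule power_network_verts)
  have S_sub: "S \<subseteq> {1..n}"
    by (auto simp: S_def successors_def verts)
  have range: "H ! p \<in> {1..n}" if "p \<in> {1..n}" for p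
    using bij that by (auto simp: bij_betw_def)
  have x_nonneg: "0 \<le> x q" if "q \<in> {1..n}" for q
    unfolding x_def by (intro travel_time_nonneg leg_in_road_network bij \<open>H ! 0 = 0\<close> that)
  \<comment> \<open>The location at position \<open>p\<close> waits at least for the first \<open>R p\<close> arcs.\<close>
  define R where "R p = (if H ! p \<in> S then max p k else p)" for p
  have arrival: "arrival_time n d H (H ! p) = (\<Sum>q = 1..p. x q)" if "p \<in> {1..n}" for p
    using visit_position_nth[OF bij that] by (simp add: arrival_time_def x_def)
  have disruption: "(\<Sum>q = 1..R p. x q) \<le> disruption_time n d T H (H ! p)" if p: "p \<in> {1..n}" for p
  proof -
    have own: "(\<Sum>q = 1..p. x q) \<le> disruption_time n d T H (H ! p)"
      using arrival_time_le_disruption_time[of T "H ! p" "H ! p" n d H] arrival[OF p] range[OF p]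
      by (simp add: verts reachable_def rtrancl_on_refl)
    have "(\<Sum>q = 1..k. x q) \<le> disruption_time n d T H (H ! p)" if "H ! p \<in> S"
      using arrival_time_le_disruption_time[of T "H ! k" "H ! p" n d H] arrival[OF k] range[OF k] that
      by (simp add: verts S_def successors_def)
    with own show ?thesis
      by (auto simp: R_def max_def)
  qed
  have count: "arc_weight n (card S) k q \<le> card {p \<in> {1..n}. q \<le> R p}" if q: "q \<in> {1..n}" for q
  proof -
    have "{q..n} \<subseteq> {p \<in> {1..n}. q \<le> R p}"
      using q by (auto simp: R_def)
    then have "card {q..n} \<le> card {p \<in> {1..n}. q \<le> R p}"
      by (intro card_mono) auto
    then have later: "n - q + 1 \<le> card {p \<in> {1..n}. q \<le> R p}"
      using q by (simp add: Suc_diff_le)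
    have "card S \<le> card {p \<in> {1..n}. q \<le> R p}" if "q \<le> k"
    proof -
      have "S \<subseteq> (!) H ` {p \<in> {1..n}. q \<le> R p}"
      proof
        fix j assume "j \<in> S"
        moreover obtain p where "p \<in> {1..n}" "j = H ! p"
          using bij S_sub \<open>j \<in> S\<close> by (metis bij_betw_imp_surj_on imageE subsetD)
        ultimately show "j \<in> (!) H ` {p \<in> {1..n}. q \<le> R p}"
          using that by (auto simp: R_def)
      qed
      then show ?thesis
        by (intro surj_card_le) auto
    qed
    with later show ?thesis
      by (auto simp: arc_weight_def)
  qed
  have R_le: "R p \<le> n" if "p \<in> {1..n}" for p
    using that k by (auto simp: R_def)
  have "(\<Sum>q = 1..n. real (arc_weight n (card S) k q) * x q)
      \<le> (\<Sum>q = 1..n. real (card {p \<in> {1..n}. q \<le> R p}) * x q)"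
    using count x_nonneg by (intro sum_mono mult_right_mono) auto
  also have "\<dots> = (\<Sum>q = 1..n. \<Sum>p | p \<in> {1..n} \<and> q \<le> R p. x q)"
    by simp
  also have "\<dots> = (\<Sum>p = 1..n. \<Sum>q | q \<in> {1..n} \<and> q \<le> R p. x q)"
    by (rule sum.swap_restrict) auto
  also have "\<dots> = (\<Sum>p = 1..n. \<Sum>q = 1..R p. x q)"
  proof (intro sum.cong refl)
    show "{q. q \<in> {1..n} \<and> q \<le> R p} = {1..R p}" if "p \<in> {1..n}" for p
      using R_le[OF that] by auto
  qed
  also have "\<dots> \<le> (\<Sum>p = 1..n. disruption_time n d T H (H ! p))"
    by (intro sum_mono disruption)
  also have "\<dots> = total_disruption_time n d T H"
    unfolding total_disruption_time_def verts by (rule sum.reindex_bij_betw[OF bij])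
  finally show ?thesis
    by (simp add: S_def x_def)
qed

theorem proposition4:
  fixes n i k :: nat
    and d :: "nat \<Rightarrow> nat \<Rightarrow> real"
    and T :: "nat pair_pre_digraph"
    and H :: "nat vwalk"
  assumes "prtrp n d T"
    and "i \<in> {1..n}"
    and "k \<in> {1..n}"
    and "k > n - card (successors T i)"
    and "hamiltonian_cycle (with_proj (road_network n)) H"
    and "hd H = 0"
    and "H ! k = i"
  shows "disruption_lower_bound n d T i k \<le> total_disruption_time n d T H"
proof -
  let ?w = "arc_weight n (card (successors T i)) k"
  have bij: "bij_betw ((!) H) {1..n} {1..n}"
    using assms by (intro hamiltonian_cycle_bij_betw)
  have depot: "H ! 0 = 0"
    using assms(5,6) by (cases H) (auto simp: hamiltonian_cycle_def)
  have "disruption_lower_bound n d T i k = (\<Sum>p = 1..n. real (?w p) * shortest_arc n d p)"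
    using assms(3) by (intro disruption_lower_bound_eq_weighted_sum) auto
  also have "\<dots> \<le> (\<Sum>q = 1..n. real (?w q) * d (H ! (q - 1)) (H ! q))"
  proof (rule weighted_sum_mono_of_prefix_sums)
    \<comment> \<open>The weight drops to \<open>n - k\<close> after position \<open>k\<close>, which is less than
      \<open>card (successors T i)\<close> by the assumption on \<open>k\<close>.\<close>
    show "real (?w (Suc q)) \<le> real (?w q)" if "1 \<le> q" "q < n" for q
      using that assms(3,4) by (auto simp: arc_weight_def)
    show "0 \<le> real (?w n)"
      by simp
    show "(\<Sum>q = 1..m. shortest_arc n d q) \<le> (\<Sum>q = 1..m. d (H ! (q - 1)) (H ! q))"
      if "m \<le> n" for m
      using bij depot that by (rule sum_shortest_arcs_le_legs)
  qed
  also have "\<dots> \<le> total_disruption_time n d T H"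
    using weighted_legs_le_total_disruption[OF assms(1) bij depot assms(3)] assms(7) by simp
  finally show ?thesis .
qed

end
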